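(* Let $r\ge 0$ be an integer. The infinite matrix $\mathcal{C}_{\ge 2,r}=\left({n \brack k}_{\ge 2,r}^{B}\right)_{n,k\ge 0}$ is the exponential Riordan array $$\left(\left(\frac{1+2z}{1-2z}\right)^{r},\; -\ln(1-2z)-z\right).$$
   Context: A signed permutation (permutation of type $B$) of $[N]=\{1,\dots,N\}$ is a bijection $\sigma$ of $\{1,\dots,N\}\cup\{\overline 1,\dots,\overline N\}$ with $\sigma(\overline j)=\overline{\sigma(j)}$ (where $\overline{\overline j}=j$). It is determined by its line notation $\sigma(1)\cdots\sigma(N)$, in which each symbol of $[N]$ appears exactly once, either colored (barred) or not. The cycles of $\sigma$ are the cycles of the permutation $|\sigma|$ of $[N]$ obtained by forgetting the bars, each symbol in a cycle being written colored or uncolored according to how it appears in the line notation. For integers $n,r\ge 0$, $\mathcal{D}_{n,r}^{B}$ is the set of signed permutations $\sigma$ of $[n+r]$ such that $\sigma(i)\ne i$ for all $i\in[n+r]$ (no fixed points; a length-one cycle $(\overline i)$, meaning $\sigma(i)=\overline i$, is allowed) and such that the $r$ special elements $1,\dots,r$ lie in distinct cycles. ${n\brack k}_{\ge 2,r}^{B}$ denotes the number of elements of $\mathcal{D}_{n,r}^{B}$ having exactly $k+r$ cycles. An infinite lower triangular matrix $(l_{n,k})_{n,k\ge0}$ is the exponential Riordan array $(g(z),f(z))$, where $g,f$ are formal power series with $g(0)\neq0$, $f(0)=0$, $f'(0)\ne 0$, if for every $k\ge 0$ its $k$-th column has exponential generating function $\sum_{n\ge0} l_{n,k}\frac{z^n}{n!}=g(z)\frac{f(z)^k}{k!}$.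 *)

theory Defs
  imports
    Complex_Main
    "HOL-Combinatorics.Combinatorics"
    "HOL-Computational_Algebra.Formal_Power_Series"
begin

text \<open>The barred symbol over \<open>j\<close> is encoded as the integer \<open>-j\<close>.\<close>

definition signed_symbols :: "nat \<Rightarrow> int set" where
  "signed_symbols N = {- int N..int N} - {0}"

text \<open>By \<^const>\<open>permutes\<close>, a signed permutation is the identity outside the symbols, so that
  distinct functions are distinct signed permutations and there are only finitely many.\<close>

definition signed_permutation :: "nat \<Rightarrow> (int \<Rightarrow> int) \<Rightarrow> bool" where
  "signed_permutation N \<sigma> \<longleftrightarrow>
     \<sigma> permutes signed_symbols N \<and> (\<forall>j\<in>signed_symbols N. \<sigma> (- j) = - \<sigma> j)"

definition forget_bars :: "(int \<Rightarrow> int) \<Rightarrow> nat \<Rightarrow> nat" where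
  "forget_bars \<sigma> i = nat \<bar>\<sigma> (int i)\<bar>"

text \<open>A cycle is represented by its support; the cyclic order and the bars are determined
  by \<open>\<sigma>\<close>.\<close>

definition cycle_at :: "(int \<Rightarrow> int) \<Rightarrow> nat \<Rightarrow> nat set" where
  "cycle_at \<sigma> i = orbit (forget_bars \<sigma>) i"

definition cycles :: "nat \<Rightarrow> (int \<Rightarrow> int) \<Rightarrow> nat set set" where
  "cycles N \<sigma> = cycle_at \<sigma> ` {1..N}"

definition derangements_B :: "nat \<Rightarrow> nat \<Rightarrow> (int \<Rightarrow> int) set" where
  "derangements_B n r = {\<sigma>. signed_permutation (n + r) \<sigma> \<and>
     (\<forall>i\<in>{1..n + r}. \<sigma> (int i) \<noteq> int i) \<and>
     (\<forall>i\<in>{1..r}. \<forall>j\<in>{1..r}. i \<noteq> j \<longrightarrow> cycle_at \<sigma> i \<noteq> cycle_at \<sigma> j)}"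

definition stirling_B_ge2 :: "nat \<Rightarrow> nat \<Rightarrow> nat \<Rightarrow> nat" where
  "stirling_B_ge2 r n k = card {\<sigma> \<in> derangements_B n r. card (cycles (n + r) \<sigma>) = k + r}"

definition is_exp_Riordan_array ::
  "(nat \<Rightarrow> nat \<Rightarrow> 'a::field_char_0) \<Rightarrow> 'a fps \<Rightarrow> 'a fps \<Rightarrow> bool" where
  "is_exp_Riordan_array l g f \<longleftrightarrow>
     fps_nth g 0 \<noteq> 0 \<and> fps_nth f 0 = 0 \<and> fps_nth (fps_deriv f) 0 \<noteq> 0 \<and>
     (\<forall>n k. n < k \<longrightarrow> l n k = 0) \<and>
     (\<forall>k. Abs_fps (\<lambda>n. l n k / fact n) = g * f ^ k / fps_const (fact k))"

end

theory Submission
  imports Defs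
begin

text \<open>
  A signed permutation is a permutation \<open>p\<close> together with a set of barred positions. It has no
  fixed point exactly when every fixed point of \<open>p\<close> is barred, so \<open>p\<close> underlies \<open>2 ^ m\<close> signed
  derangements, where \<open>m\<close> is the number of points that \<open>p\<close> moves. The bars thus disappear into a
  weight (\<open>stirling_B_ge2_eq_weighted_count\<close>). What remains is to compute the weighted number
  \<open>W S V k\<close> of the permutations of a finite set \<open>V\<close> that have \<open>card S + k\<close> cycles and keep the
  elements of \<open>S \<subseteq> V\<close> in distinct cycles.

  Insert a new nonspecial point into a permutation \<open>p\<close> of \<open>V\<close>. Either it becomes a cycle of its
  own, with weight factor 1, or it is placed directly before some \<open>b \<in> V\<close> in the cycle of \<open>b\<close>. The
  latter keeps the cycle structure; its weight factor is 2 if \<open>p\<close> moves \<open>b\<close>, and 4 if \<open>p\<close> fixes \<open>b\<close>,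
  because then \<open>b\<close> starts to move as well. Writing 4 as 2 + 2 leaves a uniform term
  \<open>2 * card V * W S V k\<close> and a correction over the pairs of \<open>b\<close> and \<open>p\<close> with \<open>p b = b\<close>
  (\<open>weighted_count_insert\<close>). The permutations of \<open>V\<close> that fix \<open>b\<close> are literally the permutations of
  \<open>V - {b}\<close>, so the correction is again made of values of \<open>W\<close>: one special element is lost if
  \<open>b \<in> S\<close>, one of the \<open>k\<close> additional cycles is lost otherwise. With \<open>card S = r\<close> and
  \<open>card (V - S) = n\<close> this reads
  \<open>W r (n + 1) k = W r n (k - 1) + 2 (n + r) W r n k + 2 r W (r - 1) n k + 2 n W r (n - 1) (k - 1)\<close>.

  On the other side, \<open>g = (1 + 2 z) / (1 - 2 z)\<close> and \<open>f = - ln (1 - 2 z) - z\<close> satisfy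
  \<open>(1 - 2 z) g' = 2 (g + 1)\<close> and \<open>(1 - 2 z) f' = 1 + 2 z\<close>. Hence the columns
  \<open>F r k = g ^ r * f ^ k / k!\<close> satisfy
  \<open>(1 - 2 z) F' r k = (1 + 2 z) F r (k - 1) + 2 r (F r k + F (r - 1) k)\<close>
  (\<open>Riordan_column_ODE\<close>), which is the same recurrence for \<open>n!\<close> times the \<open>n\<close>-th coefficient. Both
  sides agree for \<open>n = 0\<close>, so they agree throughout (\<open>weighted_count_eq_coeff\<close>).
\<close>

section \<open>Orbits under insertion of a point\<close>

lemma orbit_eq_iff_mem:
  assumes "permutation p"
  shows "orbit p x = orbit p y \<longleftrightarrow> y \<in> orbit p x"
  using assms by (metis cyclic_on_orbit' orbit_cyclic_eq3 permutation_self_in_orbit)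

text \<open>The permutation \<open>transpose a b \<circ> p\<close> runs through the cycles of \<open>p\<close>, except that it visits \<open>a\<close>
  immediately before \<open>b\<close>. Every point of an old cycle is therefore still reached, and the only point
  that can be reached in addition is \<open>a\<close>.\<close>

lemma orbit_transpose_insert:
  assumes p: "p permutes V" and a: "a \<notin> V" and b: "b \<in> V" and x: "x \<in> V"
  shows "orbit (transpose a b \<circ> p) x =
           (if b \<in> orbit p x then insert a (orbit p x) else orbit p x)"
proof -
  let ?q = "transpose a b \<circ> p"
  have pa: "p a = a" using p a by (simp add: permutes_def)
  have pV: "p y \<in> V \<longleftrightarrow> y \<in> V" for y using permutes_in_image[OF p] .
  have ab: "a \<noteq> b" using a b by auto
  have qa: "?q a = b" by (simp add: pa)
  have qb: "?q y = a" if "p y = b" for y using that by simp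
  have q: "?q y = p y" if "y \<in> V" "p y \<noteq> b" for y
    using that a pV by (metis comp_apply transpose_apply_other)
  have qV: "orbit p x \<subseteq> V" using permutes_orbit_subset[OF p x] .
  have sub: "(y = a \<longrightarrow> b \<in> orbit p x) \<and> (y \<noteq> a \<longrightarrow> y \<in> orbit p x)" if "y \<in> orbit ?q x" for y
    using that
  proof induction
    case base
    show ?case using q[OF x] qb[of x] orbit.base[of p x] a pV x by metis
  next
    case (step y)
    show ?case
    proof (cases "y = a")
      case True
      then show ?thesis using step.IH qa ab by simp
    next
      case False
      then have y: "y \<in> orbit p x" using step.IH by simp
      then have "y \<in> V" using qV by blast
      then show ?thesis using q[of y] qb[of y] orbit.step[OF y] a pV by metis
    qed
  qed
  have sup: "y \<in> orbit ?q x \<and> (y = b \<longrightarrow> a \<in> orbit ?q x)" if "y \<in> orbit p x" for y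
    using that
  proof induction
    case base
    show ?case
    proof (cases "p x = b")
      case True
      have "a \<in> orbit ?q x" using orbit.base[of ?q x] qb[OF True] by simp
      moreover from orbit.step[OF this] have "b \<in> orbit ?q x" unfolding qa .
      ultimately show ?thesis using True by metis
    next
      case False
      then show ?thesis using orbit.base[of ?q x] q[OF x] by metis
    qed
  next
    case (step y)
    show ?case
    proof (cases "p y = b")
      case True
      have "a \<in> orbit ?q x" using orbit.step[of y ?q x] step.IH qb[OF True] by simp
      moreover from orbit.step[OF this] have "b \<in> orbit ?q x" unfolding qa .
      ultimately show ?thesis using True by metis
    next
      case False
      moreover have "y \<in> V" using step.hyps qV by blast
      ultimately show ?thesis using orbit.step[of y ?q x] step.IH q[of y] by metis
    qed
  qed
  show ?thesis using sub sup by auto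
qed

lemma orbit_transpose_insert_new:
  assumes p: "p permutes V" and fin: "finite V" and a: "a \<notin> V" and b: "b \<in> V"
  shows "orbit (transpose a b \<circ> p) a = insert a (orbit p b)"
proof -
  let ?q = "transpose a b \<circ> p"
  have "permutation p" using p fin by (rule permutes_imp_permutation[rotated])
  then have bb: "b \<in> orbit p b" by (rule permutation_self_in_orbit)
  have "permutation ?q" using \<open>permutation p\<close> by (simp add: permutation_compose permutation_swap_id)
  moreover have ob: "orbit ?q b = insert a (orbit p b)"
    using orbit_transpose_insert[OF p a b b] bb by simp
  ultimately show ?thesis using orbit_eq_iff_mem[of ?q b a] by simp
qed

section \<open>Permutations separating a set\<close>

definition separates :: "'a set \<Rightarrow> 'a set \<Rightarrow> nat \<Rightarrow> ('a \<Rightarrow> 'a) \<Rightarrow> bool" where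
  "separates S V k p \<longleftrightarrow> inj_on (orbit p) S \<and> card (orbit p ` V) = card S + k"

text \<open>The weight of \<open>p\<close> is the number of ways to bar its values such that every fixed point is
  barred.\<close>

definition weighted_count :: "'a set \<Rightarrow> 'a set \<Rightarrow> nat \<Rightarrow> nat" where
  "weighted_count S V k = (\<Sum>p | p permutes V \<and> separates S V k p. 2 ^ card {x. p x \<noteq> x})"

text \<open>Inserting \<open>a\<close> into an existing cycle only enlarges that cycle, so the map \<open>\<psi>\<close> in the proof
  identifies the old cycles with the new ones.\<close>

lemma separates_insert_inside:
  assumes p: "p permutes V" and fin: "finite V" and a: "a \<notin> V" and b: "b \<in> V" and S: "S \<subseteq> V"
  shows "separates S (insert a V) k (transpose a b \<circ> p) \<longleftrightarrow> separates S V k p"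
proof -
  let ?q = "transpose a b \<circ> p"
  define \<psi> where "\<psi> = (\<lambda>c. if b \<in> c then insert a c else c)"
  have perm: "permutation p" using p fin by (rule permutes_imp_permutation[rotated])
  have oq: "orbit ?q x = \<psi> (orbit p x)" if "x \<in> V" for x
    using orbit_transpose_insert[OF p a b that] by (simp add: \<psi>_def)
  have oa: "orbit ?q a = \<psi> (orbit p b)"
    using orbit_transpose_insert_new[OF p fin a b] permutation_self_in_orbit[OF perm, of b]
    by (simp add: \<psi>_def)
  have na: "a \<notin> orbit p x" if "x \<in> V" for x
    using permutes_orbit_subset[OF p that] a by blast
  have inj: "inj_on \<psi> (orbit p ` V)"
  proof (rule inj_onI)
    fix c d assume c: "c \<in> orbit p ` V" and d: "d \<in> orbit p ` V" and eq: "\<psi> c = \<psi> d"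
    \<comment> \<open>Deleting \<open>a\<close> undoes \<open>\<psi>\<close>, as no old cycle contains \<open>a\<close>.\<close>
    have "\<psi> c - {a} = c" "\<psi> d - {a} = d" using c d na by (auto simp: \<psi>_def)
    then show "c = d" using eq by metis
  qed
  have "orbit ?q ` insert a V = \<psi> ` orbit p ` V"
    using oq oa b by (auto simp: image_iff)
  then have "card (orbit ?q ` insert a V) = card (orbit p ` V)"
    using inj by (simp add: card_image)
  moreover have "inj_on (orbit ?q) S \<longleftrightarrow> inj_on (orbit p) S"
  proof -
    have "orbit ?q x = orbit ?q y \<longleftrightarrow> orbit p x = orbit p y" if "x \<in> S" "y \<in> S" for x y
    proof -
      have V: "x \<in> V" "y \<in> V" using that S by auto
      show ?thesis unfolding oq[OF V(1)] oq[OF V(2)]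
        using inj_on_eq_iff[OF inj, of "orbit p x" "orbit p y"] V by blast
    qed
    then show ?thesis unfolding inj_on_def by blast
  qed
  ultimately show ?thesis by (simp add: separates_def)
qed

text \<open>The inserted point is moved; so is \<open>b\<close>, since its predecessor is now \<open>a\<close>.\<close>

lemma card_moved_insert_inside:
  assumes p: "p permutes V" and fin: "finite V" and a: "a \<notin> V" and b: "b \<in> V"
  shows "card {x. (transpose a b \<circ> p) x \<noteq> x} = card {x. p x \<noteq> x} + (if p b = b then 2 else 1)"
proof -
  have pa: "p a = a" using p a by (simp add: permutes_def)
  have ab: "a \<noteq> b" using a b by auto
  have inj: "p x = p y \<longleftrightarrow> x = y" for x y using permutes_inj[OF p] by (auto simp: inj_def)
  have sub: "{x. p x \<noteq> x} \<subseteq> V" using p by (auto simp: permutes_def)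
  have "{x. (transpose a b \<circ> p) x \<noteq> x} = insert a (insert b {x. p x \<noteq> x})"
    using pa ab inj by (auto simp: transpose_def)
  then show ?thesis
    using finite_subset[OF sub fin] pa ab by (simp add: insert_absorb)
qed

lemma card_orbits_remove_fixed:
  assumes p: "p permutes V" and fin: "finite V" and b: "b \<in> V" and pb: "p b = b"
  shows "card (orbit p ` V) = Suc (card (orbit p ` (V - {b})))"
    and "b \<notin> S \<Longrightarrow> S \<subseteq> V \<Longrightarrow> inj_on (orbit p) (insert b S) \<longleftrightarrow> inj_on (orbit p) S"
proof -
  have perm: "permutation p" using p fin by (rule permutes_imp_permutation[rotated])
  have ob: "orbit p b = {b}" using pb by (simp add: orbit_eq_singleton_iff)
  have ne: "orbit p x \<noteq> {b}" if "x \<noteq> b" for x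
    using permutation_self_in_orbit[OF perm, of x] that by auto
  have "orbit p ` V = insert {b} (orbit p ` (V - {b}))" using b ob by (auto simp: image_iff)
  moreover have "{b} \<notin> orbit p ` (V - {b})" using ne by (metis DiffD2 imageE singletonI)
  ultimately show "card (orbit p ` V) = Suc (card (orbit p ` (V - {b})))" using fin by simp
  show "inj_on (orbit p) (insert b S) \<longleftrightarrow> inj_on (orbit p) S" if "b \<notin> S" "S \<subseteq> V"
    proof -
    have "{b} \<notin> orbit p ` S" using ne that by (metis imageE)
    then show ?thesis using that ob by (simp add: inj_on_insert)
  qed
qed

lemma card_le_card_orbits:
  assumes "inj_on (orbit p) S" "S \<subseteq> V" "finite V"
  shows "card S \<le> card (orbit p ` V)"
  using assms by (metis card_image card_mono finite_imageI image_mono)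

lemma separates_fixed_special:
  assumes p: "p permutes V" and fin: "finite V" and S: "S \<subseteq> V" and b: "b \<in> S" and pb: "p b = b"
  shows "separates S V k p \<longleftrightarrow> separates (S - {b}) (V - {b}) k p"
proof -
  have bV: "b \<in> V" using b S by blast
  have "card S = Suc (card (S - {b}))"
    using b S fin by (metis card.remove finite_subset)
  moreover have "inj_on (orbit p) S \<longleftrightarrow> inj_on (orbit p) (S - {b})"
    using card_orbits_remove_fixed(2)[OF p fin bV pb, of "S - {b}"] b S by (auto simp: insert_absorb)
  ultimately show ?thesis
    using card_orbits_remove_fixed(1)[OF p fin bV pb] by (simp add: separates_def)
qed

text \<open>For \<open>k = 0\<close> every cycle contains an element of \<open>S\<close>, which leaves no room for the one-point
  cycle of a \<open>b\<close> outside \<open>S\<close>.\<close>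

lemma separates_fixed_nonspecial:
  assumes p: "p permutes V" and fin: "finite V" and S: "S \<subseteq> V" and b: "b \<in> V - S" and pb: "p b = b"
  shows "separates S V k p \<longleftrightarrow> (\<exists>j. k = Suc j \<and> separates S (V - {b}) j p)"
proof -
  have bV: "b \<in> V" using b by blast
  have "card S \<le> card (orbit p ` (V - {b}))" if "inj_on (orbit p) S"
    using card_le_card_orbits[OF that, of "V - {b}"] S b fin by blast
  then show ?thesis
    using card_orbits_remove_fixed(1)[OF p fin bV pb]
    by (cases k) (auto simp: separates_def)
qed

lemma permutes_fixed_iff: "p permutes V \<and> p b = b \<longleftrightarrow> p permutes (V - {b})"
proof
  show "p permutes V - {b} \<Longrightarrow> p permutes V \<and> p b = b"
    using permutes_subset[of p "V - {b}" V] permutes_not_in[of p "V - {b}" b] by auto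
  show "p permutes V \<and> p b = b \<Longrightarrow> p permutes V - {b}"
    by (rule permutes_superset[of _ V]) auto
qed

lemma weighted_count_fixed_special:
  assumes "finite V" "S \<subseteq> V" "b \<in> S"
  shows "(\<Sum>p | p permutes V \<and> separates S V k p \<and> p b = b. 2 ^ card {x. p x \<noteq> x})
           = weighted_count (S - {b}) (V - {b}) k"
  unfolding weighted_count_def
proof (rule sum.cong[OF _ refl])
  show "{p. p permutes V \<and> separates S V k p \<and> p b = b} =
        {p. p permutes V - {b} \<and> separates (S - {b}) (V - {b}) k p}"
    using separates_fixed_special[OF _ assms] permutes_fixed_iff[of _ V b] by blast
qed

lemma weighted_count_fixed_nonspecial:
  assumes "finite V" "S \<subseteq> V" "b \<in> V - S"
  shows "(\<Sum>p | p permutes V \<and> separates S V k p \<and> p b = b. 2 ^ card {x. p x \<noteq> x})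
           = (case k of 0 \<Rightarrow> 0 | Suc j \<Rightarrow> weighted_count S (V - {b}) j)"
proof -
  have *: "{p. p permutes V \<and> separates S V k p \<and> p b = b} =
        {p. p permutes V - {b} \<and> (\<exists>j. k = Suc j \<and> separates S (V - {b}) j p)}"
    using separates_fixed_nonspecial[OF _ assms] permutes_fixed_iff[of _ V b] by blast
  show ?thesis unfolding * by (simp add: weighted_count_def split: nat.split)
qed

text \<open>In the sum over all permutations of \<open>insert a V\<close>, written as \<open>transpose a b \<circ> q\<close> with
  \<open>q permutes V\<close>, the term \<open>b = a\<close> collects those in which \<open>a\<close> is a cycle of its own. For \<open>b \<in> V\<close> the
  weight factor, 2 or 4, is split into 2 and an extra 2 for the \<open>q\<close> that fix \<open>b\<close>.\<close>

lemma weighted_count_insert: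
  assumes fin: "finite V" and S: "S \<subseteq> V" and a: "a \<notin> V"
  shows "weighted_count S (insert a V) k =
           (case k of 0 \<Rightarrow> 0 | Suc j \<Rightarrow> weighted_count S V j) + 2 * card V * weighted_count S V k
           + 2 * (\<Sum>b\<in>V. \<Sum>p | p permutes V \<and> separates S V k p \<and> p b = b. 2 ^ card {x. p x \<noteq> x})"
proof -
  let ?w = "\<lambda>p :: 'a \<Rightarrow> 'a. (2::nat) ^ card {x. p x \<noteq> x}"
  let ?P = "{p. p permutes V}"
  have finP: "finite ?P" using fin by (rule finite_permutations)
  have finP': "finite {p. p permutes insert a V}" using fin by (intro finite_permutations) simp
  let ?h = "\<lambda>q. if separates S (insert a V) k q then ?w q else 0"
  have old: "weighted_count S V k = (\<Sum>p\<in>?P. if separates S V k p then ?w p else 0)"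
    unfolding weighted_count_def by (subst sum.inter_filter[OF finP, symmetric]) simp
  have fixed_a: "(\<Sum>q\<in>?P. ?h (transpose a a \<circ> q)) =
      (case k of 0 \<Rightarrow> 0 | Suc j \<Rightarrow> weighted_count S V j)"
  proof -
    have "(\<Sum>q\<in>?P. ?h (transpose a a \<circ> q)) =
        (\<Sum>p | p permutes V \<and> separates S (insert a V) k p. ?w p)"
      by (subst sum.inter_filter[OF finP, symmetric]) simp
    also have "\<dots> = (\<Sum>p | p permutes insert a V \<and> separates S (insert a V) k p \<and> p a = a. ?w p)"
      using permutes_fixed_iff[of _ "insert a V" a] a by (intro sum.cong) auto
    also have "\<dots> = (case k of 0 \<Rightarrow> 0 | Suc j \<Rightarrow> weighted_count S V j)"
    proof -
      have "insert a V - {a} = V" "S \<subseteq> insert a V" "a \<in> insert a V - S" using S a by auto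
      then show ?thesis
        using weighted_count_fixed_nonspecial[of "insert a V" S a k] fin by (metis finite_insert)
    qed
    finally show ?thesis .
  qed
  have moved_a: "(\<Sum>q\<in>?P. ?h (transpose a b \<circ> q)) = 2 * weighted_count S V k
      + 2 * (\<Sum>p | p permutes V \<and> separates S V k p \<and> p b = b. ?w p)" if b: "b \<in> V" for b
  proof -
    have "(\<Sum>q\<in>?P. ?h (transpose a b \<circ> q)) =
      (\<Sum>q\<in>?P. 2 * (if separates S V k q then ?w q else 0)
          + 2 * (if separates S V k q \<and> q b = b then ?w q else 0))"
    proof (rule sum.cong[OF refl])
      fix q assume "q \<in> ?P"
      then have q: "q permutes V" by simp
      show "?h (transpose a b \<circ> q) = 2 * (if separates S V k q then ?w q else 0)
          + 2 * (if separates S V k q \<and> q b = b then ?w q else 0)"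
        unfolding separates_insert_inside[OF q fin a b S] card_moved_insert_inside[OF q fin a b]
        by (simp add: power_add)
    qed
    also have "\<dots> = 2 * weighted_count S V k
      + 2 * (\<Sum>p\<in>?P. if separates S V k p \<and> p b = b then ?w p else 0)"
      unfolding old by (simp add: sum.distrib sum_distrib_left)
    also have "(\<Sum>p\<in>?P. if separates S V k p \<and> p b = b then ?w p else 0) =
       (\<Sum>p | p permutes V \<and> separates S V k p \<and> p b = b. ?w p)"
      by (subst sum.inter_filter[OF finP, symmetric]) simp
    finally show ?thesis .
  qed
  have "weighted_count S (insert a V) k = sum ?h {p. p permutes insert a V}"
    unfolding weighted_count_def by (subst sum.inter_filter[OF finP', symmetric]) simp
  also have "\<dots> = (\<Sum>b\<in>insert a V. \<Sum>q\<in>?P. ?h (transpose a b \<circ> q))"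
    by (rule sum_over_permutations_insert[OF fin a])
  also have "\<dots> = (\<Sum>q\<in>?P. ?h (transpose a a \<circ> q)) + (\<Sum>b\<in>V. \<Sum>q\<in>?P. ?h (transpose a b \<circ> q))"
    using fin a by (rule sum.insert)
  also have "(\<Sum>b\<in>V. \<Sum>q\<in>?P. ?h (transpose a b \<circ> q)) = (\<Sum>b\<in>V. 2 * weighted_count S V k
      + 2 * (\<Sum>p | p permutes V \<and> separates S V k p \<and> p b = b. ?w p))"
    by (rule sum.cong[OF refl moved_a])
  finally show ?thesis unfolding fixed_a by (simp add: sum.distrib sum_distrib_left)
qed

text \<open>If all points are special, every cycle is a single point, and the identity is the only
  permutation left.\<close>

lemma weighted_count_self:
  assumes fin: "finite S"
  shows "weighted_count S S k = (if k = 0 then 1 else 0)"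
proof -
  have "p = id" if p: "p permutes S" and inj: "inj_on (orbit p) S" for p
  proof
    fix x
    have perm: "permutation p" using p fin by (rule permutes_imp_permutation[rotated])
    show "p x = id x"
    proof (cases "x \<in> S")
      case True
      then have "p x \<in> S" using permutes_in_image[OF p] by blast
      then show ?thesis
        using inj_onD[OF inj permutation_orbit_step[OF perm, of x]] True by simp
    next
      case False
      then show ?thesis using p by (simp add: permutes_def)
    qed
  qed
  moreover have "inj_on (orbit id) S"
    by (rule inj_onI) (metis id_apply orbit_eq_singleton_iff singleton_inject)
  moreover have "card (orbit p ` S) = card S" if "inj_on (orbit p) S" for p :: "'a \<Rightarrow> 'a"
    using that by (rule card_image)
  ultimately have "{p. p permutes S \<and> separates S S k p} = (if k = 0 then {id} else {})"
    by (auto simp: separates_def permutes_id)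
  then show ?thesis by (simp add: weighted_count_def)
qed

section \<open>The recurrence for the columns of the Riordan array\<close>

unbundle fps_syntax

definition Riordan_column :: "'a::field_char_0 fps \<Rightarrow> 'a fps \<Rightarrow> nat \<Rightarrow> nat \<Rightarrow> 'a fps" where
  "Riordan_column g f r k = g ^ r * f ^ k / fps_const (fact k)"

text \<open>The first hypothesis gives \<open>(1 - 2 z) g' = 2 (g + 1)\<close>; the constant 1 here is what produces
  \<open>g ^ (r - 1)\<close>, the column for one special element fewer. For \<open>r = 0\<close> the truncated index
  \<open>r - 1\<close> is harmless, because of the factor \<open>2 * r\<close>.\<close>

lemma Riordan_column_ODE:
  fixes g f :: "'a::field_char_0 fps"
  assumes g: "(1 - 2 * fps_X) * g = 1 + 2 * fps_X"
    and f: "(1 - 2 * fps_X) * fps_deriv f = 1 + 2 * fps_X"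
  shows "(1 - 2 * fps_X) * fps_deriv (Riordan_column g f r k) =
    (1 + 2 * fps_X) * (case k of 0 \<Rightarrow> 0 | Suc j \<Rightarrow> Riordan_column g f r j)
    + of_nat (2 * r) * (Riordan_column g f r k + Riordan_column g f (r - 1) k)"
proof -
  let ?D = "1 - 2 * fps_X :: 'a fps"
  define h where "h = (\<lambda>k. fps_const (1 / fact k) * f ^ k)"
  have col: "Riordan_column g f r k = g ^ r * h k" for r k
    by (simp add: Riordan_column_def h_def fps_divide_unit fps_const_inverse divide_inverse ac_simps)
  have "fps_deriv (?D * g) = 2"
    unfolding g by simp
  then have g': "?D * fps_deriv g = 2 * (g + 1)"
    by (simp add: algebra_simps)
  have gr: "?D * fps_deriv (g ^ r) = of_nat (2 * r) * (g ^ r + g ^ (r - 1))"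
  proof (cases r)
    case (Suc m)
    have "?D * fps_deriv (g ^ r) = of_nat r * (?D * fps_deriv g) * g ^ (r - 1)"
      by (simp add: fps_deriv_power fps_of_nat ac_simps)
    also have "\<dots> = of_nat (2 * r) * (g ^ r + g ^ (r - 1))"
      unfolding g' by (simp add: Suc algebra_simps)
    finally show ?thesis .
  qed simp
  have hk: "?D * fps_deriv (h k) = (1 + 2 * fps_X) * (case k of 0 \<Rightarrow> 0 | Suc j \<Rightarrow> h j)"
  proof (cases k)
    case (Suc j)
    have c: "fps_const (1 / fact (Suc j)) * fps_const (of_nat (Suc j)) = (fps_const (1 / fact j) :: 'a fps)"
      by (simp add: field_simps del: of_nat_Suc)
    have "?D * fps_deriv (h k) =
        fps_const (1 / fact (Suc j)) * fps_const (of_nat (Suc j)) * (?D * fps_deriv f) * f ^ j"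
      by (simp add: h_def Suc fps_deriv_power ac_simps
          del: power_Suc fact_Suc of_nat_Suc fps_const_mult)
    also have "\<dots> = (1 + 2 * fps_X) * h j"
      unfolding c f by (simp add: h_def ac_simps)
    finally show ?thesis using Suc by simp
  qed (simp add: h_def)
  have "?D * fps_deriv (g ^ r * h k) = g ^ r * (?D * fps_deriv (h k)) + (?D * fps_deriv (g ^ r)) * h k"
    by (simp add: algebra_simps)
  also have "\<dots> = (1 + 2 * fps_X) * (case k of 0 \<Rightarrow> 0 | Suc j \<Rightarrow> g ^ r * h j)
      + of_nat (2 * r) * (g ^ r * h k + g ^ (r - 1) * h k)"
    unfolding hk gr by (simp add: algebra_simps split: nat.split)
  finally show ?thesis unfolding col .
qed

text \<open>This is the differential equation read off at \<open>z ^ m\<close> and multiplied by \<open>m!\<close>. The last term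
  comes from the summand \<open>2 z\<close> of \<open>1 + 2 z\<close>, which shifts the coefficient index by one; its factor
  \<open>m\<close> is the quotient of \<open>m!\<close> and \<open>(m - 1)!\<close> for \<open>m > 0\<close>, and discards the term for \<open>m = 0\<close>.\<close>

lemma Riordan_column_coeff_recurrence:
  fixes g f :: "'a::field_char_0 fps"
  assumes g: "(1 - 2 * fps_X) * g = 1 + 2 * fps_X"
    and f: "(1 - 2 * fps_X) * fps_deriv f = 1 + 2 * fps_X"
  defines "c \<equiv> \<lambda>r k n. fact n * Riordan_column g f r k $ n"
  shows "c r k (Suc m) = (case k of 0 \<Rightarrow> 0 | Suc j \<Rightarrow> c r j m) + of_nat (2 * (m + r)) * c r k m
    + of_nat (2 * r) * c (r - 1) k m
    + of_nat (2 * m) * (case k of 0 \<Rightarrow> 0 | Suc j \<Rightarrow> c r j (m - 1))"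
proof -
  let ?F = "Riordan_column g f"
  let ?G = "case k of 0 \<Rightarrow> 0 | Suc j \<Rightarrow> ?F r j"
  have X2: "(2 * fps_X * A) $ m = (if m = 0 then 0 else 2 * A $ (m - 1))" for A :: "'a fps"
    by (simp add: mult.assoc numeral_fps_const)
  have nat_mult: "(of_nat j * A) $ m = of_nat j * A $ m" for j and A :: "'a fps"
    by (simp add: fps_of_nat[symmetric])
  have "((1 - 2 * fps_X) * fps_deriv (?F r k)) $ m =
    ((1 + 2 * fps_X) * ?G + of_nat (2 * r) * (?F r k + ?F (r - 1) k)) $ m"
    unfolding Riordan_column_ODE[OF g f] ..
  then have eq: "of_nat (Suc m) * ?F r k $ Suc m = of_nat (2 * (m + r)) * ?F r k $ m
      + ?G $ m + (if m = 0 then 0 else 2 * ?G $ (m - 1)) + of_nat (2 * r) * ?F (r - 1) k $ m"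
    unfolding left_diff_distrib distrib_right distrib_left mult_1_left
      fps_add_nth fps_sub_nth X2 nat_mult
    by (cases m) (simp_all add: algebra_simps)
  have "c r k (Suc m) = fact m * (of_nat (Suc m) * ?F r k $ Suc m)"
    by (simp add: c_def ac_simps del: of_nat_Suc)
  also have "\<dots> = (case k of 0 \<Rightarrow> 0 | Suc j \<Rightarrow> c r j m) + of_nat (2 * (m + r)) * c r k m
    + of_nat (2 * r) * c (r - 1) k m
    + of_nat (2 * m) * (case k of 0 \<Rightarrow> 0 | Suc j \<Rightarrow> c r j (m - 1))"
    unfolding eq c_def by (cases m; cases k) (simp_all add: algebra_simps)
  finally show ?thesis .
qed

text \<open>Stating the result for arbitrary sets instead of intervals lets the induction remove any
  point; that the weighted count depends only on cardinalities is part of the conclusion. The induction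
  is on the number of nonspecial points. Deleting a fixed special point leaves that number equal to
  \<open>m\<close>, still below the \<open>m + 1\<close> of the goal.\<close>

lemma weighted_count_eq_coeff:
  fixes g f :: "'a::field_char_0 fps"
  assumes g: "(1 - 2 * fps_X) * g = 1 + 2 * fps_X"
    and f: "(1 - 2 * fps_X) * fps_deriv f = 1 + 2 * fps_X" and f0: "f $ 0 = 0"
    and "finite (V :: 'b set)" "S \<subseteq> V"
  shows "of_nat (weighted_count S V k) =
    fact (card (V - S)) * Riordan_column g f (card S) k $ card (V - S)"
  using assms(4,5)
proof (induction "card (V - S)" arbitrary: S V k rule: less_induct)
  case less
  note fin = less.prems(1) and S = less.prems(2)
  let ?c = "\<lambda>r k n. fact n * Riordan_column g f r k $ n"
  show ?case
  proof (cases "V - S = {}")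
    case True
    then have "V = S" using S by blast
    have "g $ 0 = 1" using arg_cong[OF g, of "\<lambda>h. h $ 0"] by (simp add: fps_mult_nth)
    then have "?c (card S) k 0 = (if k = 0 then 1 else 0)"
      by (simp add: Riordan_column_def fps_divide_unit fps_const_inverse f0 zero_power fps_nth_power_0)
    then show ?thesis using True weighted_count_self[of S k] fin \<open>V = S\<close> by simp
  next
    case False
    then obtain a where a: "a \<in> V - S" by blast
    define U where "U = V - {a}"
    define r m where "r = card S" and "m = card (U - S)"
    have U: "finite U" "S \<subseteq> U" "a \<notin> U" "V = insert a U" using fin S a by (auto simp: U_def)
    have VS: "V - S = insert a (U - S)" "a \<notin> U - S" using U a by auto
    have Suc_m: "card (V - S) = Suc m" unfolding m_def VS(1) using U VS(2) by simp
    have finS: "finite S" using U finite_subset by blast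
    have "U = (U - S) \<union> S" using U by blast
    then have card_U: "card U = m + r" unfolding m_def r_def
      using U finS card_Un_disjoint[of "U - S" S] by auto
    have IH: "of_nat (weighted_count T W j) = ?c (card T) j (card (W - T))"
      if "finite W" "T \<subseteq> W" "card (W - T) \<le> m" for T W :: "'b set" and j
      using less.hyps[of W T j] that Suc_m by simp
    have special: "of_nat (weighted_count (S - {b}) (U - {b}) k) = ?c (r - 1) k m" if "b \<in> S" for b
    proof -
      have "U - {b} - (S - {b}) = U - S" using that by blast
      then show ?thesis using IH[of "U - {b}" "S - {b}" k] U finS that
        by (auto simp: r_def m_def)
    qed
    have nonspecial: "of_nat (weighted_count S (U - {b}) j) = ?c r j (m - 1)" if "b \<in> U - S" for b j
    proof -
      have "U - {b} - S = U - S - {b}" by blast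
      then have "card (U - {b} - S) = m - 1" using U that by (simp add: m_def)
      then show ?thesis using IH[of "U - {b}" S j] U that by (auto simp: r_def)
    qed
    let ?fix = "\<lambda>b. \<Sum>p | p permutes U \<and> separates S U k p \<and> p b = b. 2 ^ card {x. p x \<noteq> x} :: nat"
    have "of_nat (\<Sum>b\<in>U. ?fix b) = (\<Sum>b\<in>S. of_nat (?fix b)) + (\<Sum>b\<in>U - S. of_nat (?fix b) :: 'a)"
      using sum.subset_diff[OF U(2,1), of "\<lambda>b. of_nat (?fix b) :: 'a"]
      by (simp only: of_nat_sum add.commute)
    also have "(\<Sum>b\<in>S. of_nat (?fix b)) = (\<Sum>b\<in>S. ?c (r - 1) k m)"
      using special by (intro sum.cong[OF refl]) (simp only: weighted_count_fixed_special[OF U(1,2)])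
    also have "(\<Sum>b\<in>U - S. of_nat (?fix b)) = (\<Sum>b\<in>U - S. case k of 0 \<Rightarrow> 0 | Suc j \<Rightarrow> ?c r j (m - 1))"
      using nonspecial
      by (intro sum.cong[OF refl])
        (simp only: weighted_count_fixed_nonspecial[OF U(1,2)], simp split: nat.split)
    finally have fix_sum: "of_nat (\<Sum>b\<in>U. ?fix b) = of_nat r * ?c (r - 1) k m
        + of_nat m * (case k of 0 \<Rightarrow> 0 | Suc j \<Rightarrow> ?c r j (m - 1))"
      by (simp add: r_def m_def)
    have same: "of_nat (weighted_count S U j) = ?c r j m" for j
      using IH[of U S j] U by (simp add: r_def m_def)
    have "of_nat (weighted_count S V k) = (case k of 0 \<Rightarrow> 0 | Suc j \<Rightarrow> of_nat (weighted_count S U j))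
        + 2 * of_nat (m + r) * of_nat (weighted_count S U k) + 2 * of_nat (\<Sum>b\<in>U. ?fix b)"
      unfolding U(4) weighted_count_insert[OF U(1-3)] card_U
      by (simp only: of_nat_add of_nat_mult of_nat_numeral) (simp split: nat.split)
    also have "\<dots> = ?c r k (Suc m)"
      unfolding fix_sum same Riordan_column_coeff_recurrence[OF g f]
      by (simp add: algebra_simps)
    finally show ?thesis unfolding Suc_m r_def .
  qed
qed

section \<open>Signed derangements as permutations with barred positions\<close>

text \<open>The factor \<open>sgn j\<close> makes the function odd, as the condition on negated symbols requires.\<close>

definition put_bars :: "nat set \<Rightarrow> (nat \<Rightarrow> nat) \<Rightarrow> int \<Rightarrow> int" where
  "put_bars B p j = sgn j * (if nat \<bar>j\<bar> \<in> B then - 1 else 1) * int (p (nat \<bar>j\<bar>))"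

lemma put_bars_minus: "put_bars B p (- j) = - put_bars B p j"
  by (simp add: put_bars_def)

lemma abs_put_bars: "p 0 = 0 \<Longrightarrow> \<bar>put_bars B p j\<bar> = int (p (nat \<bar>j\<bar>))"
  by (cases "j = 0") (simp_all add: put_bars_def abs_mult abs_sgn_eq)

lemma put_bars_of_nat: "p 0 = 0 \<Longrightarrow> put_bars B p (int i) = (if i \<in> B then - int (p i) else int (p i))"
  by (cases "i = 0") (simp_all add: put_bars_def)

lemma forget_bars_put_bars: "p 0 = 0 \<Longrightarrow> forget_bars (put_bars B p) = p"
  by (rule ext) (simp add: forget_bars_def abs_put_bars)

lemma signed_permutation_minus:
  assumes "signed_permutation N \<sigma>"
  shows "\<sigma> (- j) = - \<sigma> j"
proof (cases "j \<in> signed_symbols N")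
  case True
  then show ?thesis using assms by (simp add: signed_permutation_def)
next
  case False
  then have "- j \<notin> signed_symbols N" by (auto simp: signed_symbols_def)
  then show ?thesis using False assms by (simp add: signed_permutation_def permutes_def)
qed

lemma signed_permutation_forget_bars:
  assumes \<sigma>: "signed_permutation N \<sigma>"
  shows "forget_bars \<sigma> permutes {1..N}"
proof (rule bij_imp_permutes)
  have perm: "\<sigma> permutes signed_symbols N" using \<sigma> by (simp add: signed_permutation_def)
  have inj: "inj_on (forget_bars \<sigma>) {1..N}"
  proof (rule inj_onI)
    fix i j assume ij: "i \<in> {1..N}" "j \<in> {1..N}" and "forget_bars \<sigma> i = forget_bars \<sigma> j"
    then have "\<bar>\<sigma> (int i)\<bar> = \<bar>\<sigma> (int j)\<bar>" by (simp add: forget_bars_def)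
    then have "\<sigma> (int i) = \<sigma> (int j) \<or> \<sigma> (int i) = \<sigma> (- int j)"
      unfolding signed_permutation_minus[OF \<sigma>] by linarith
    then have "int i = int j \<or> int i = - int j"
      unfolding inj_eq[OF permutes_inj[OF perm]] .
    then show "i = j" using ij by auto
  qed
  have sub: "forget_bars \<sigma> ` {1..N} \<subseteq> {1..N}"
  proof
    fix y assume "y \<in> forget_bars \<sigma> ` {1..N}"
    then obtain i where i: "i \<in> {1..N}" "y = forget_bars \<sigma> i" by blast
    then have "int i \<in> signed_symbols N" by (auto simp: signed_symbols_def)
    then have "\<sigma> (int i) \<in> signed_symbols N" using permutes_in_image[OF perm] by blast
    then show "y \<in> {1..N}" using i by (auto simp: signed_symbols_def forget_bars_def)
  qed
  show "bij_betw (forget_bars \<sigma>) {1..N} {1..N}"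
    unfolding bij_betw_def using inj endo_inj_surj[OF finite_atLeastAtMost sub inj] by (rule conjI)
  show "forget_bars \<sigma> i = i" if "i \<notin> {1..N}" for i
  proof -
    have "int i \<notin> signed_symbols N" using that by (auto simp: signed_symbols_def)
    then show ?thesis using perm by (simp add: permutes_def forget_bars_def)
  qed
qed

lemma signed_permutation_put_bars:
  assumes p: "p permutes {1..N}" and B: "B \<subseteq> {1..N}"
  shows "signed_permutation N (put_bars B p)"
proof -
  have p0: "p 0 = 0" using p by (simp add: permutes_def)
  note abs = abs_put_bars[where p = p and B = B, OF p0]
  have pN: "p i \<in> {1..N} \<longleftrightarrow> i \<in> {1..N}" for i using permutes_in_image[OF p] .
  have sym: "j \<in> signed_symbols N \<longleftrightarrow> nat \<bar>j\<bar> \<in> {1..N}" for j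
    by (auto simp: signed_symbols_def)
  have inj: "inj_on (put_bars B p) (signed_symbols N)"
  proof (rule inj_onI)
    fix i j assume ij: "i \<in> signed_symbols N" "j \<in> signed_symbols N"
      and eq: "put_bars B p i = put_bars B p j"
    then have "p (nat \<bar>i\<bar>) = p (nat \<bar>j\<bar>)" using abs[of i] abs[of j] by simp
    then have "\<bar>i\<bar> = \<bar>j\<bar>" unfolding inj_eq[OF permutes_inj[OF p]] by simp
    moreover have "i \<noteq> - j"
    proof
      assume "i = - j"
      then have "put_bars B p j = 0" using eq by (simp add: put_bars_minus)
      then have "p (nat \<bar>j\<bar>) = 0" using abs[of j] by simp
      then show False using ij(2) pN[of "nat \<bar>j\<bar>"] unfolding sym by simp
    qed
    ultimately show "i = j" by linarith
  qed
  have sub: "put_bars B p ` signed_symbols N \<subseteq> signed_symbols N"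
    using abs pN by (auto simp: sym)
  have "finite (signed_symbols N)" by (simp add: signed_symbols_def)
  then have "bij_betw (put_bars B p) (signed_symbols N) (signed_symbols N)"
    unfolding bij_betw_def using inj endo_inj_surj[OF _ sub inj] by blast
  moreover have "put_bars B p j = j" if "j \<notin> signed_symbols N" for j
  proof -
    have "nat \<bar>j\<bar> \<notin> B" "p (nat \<bar>j\<bar>) = nat \<bar>j\<bar>"
      using that B p unfolding sym by (auto simp: permutes_def)
    then show ?thesis by (simp add: put_bars_def sgn_mult_abs)
  qed
  ultimately have "put_bars B p permutes signed_symbols N" by (rule bij_imp_permutes)
  then show ?thesis by (simp add: signed_permutation_def put_bars_minus)
qed

text \<open>Both sides are odd functions, so it suffices to compare them on nonnegative integers.\<close>

lemma put_bars_forget_bars: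
  assumes \<sigma>: "signed_permutation N \<sigma>"
  shows "put_bars {i \<in> {1..N}. \<sigma> (int i) < 0} (forget_bars \<sigma>) = \<sigma>"
proof -
  let ?B = "{i \<in> {1..N}. \<sigma> (int i) < 0}"
  have perm: "\<sigma> permutes signed_symbols N" using \<sigma> by (simp add: signed_permutation_def)
  have "\<sigma> 0 = 0" using perm by (simp add: permutes_def signed_symbols_def)
  then have f0: "forget_bars \<sigma> 0 = 0" by (simp add: forget_bars_def)
  have nat: "put_bars ?B (forget_bars \<sigma>) (int i) = \<sigma> (int i)" for i
  proof (cases "i \<in> {1..N}")
    case True
    then show ?thesis
      unfolding put_bars_of_nat[where p = "forget_bars \<sigma>", OF f0] by (simp add: forget_bars_def)
  next
    case False
    then have "\<sigma> (int i) = int i" using perm by (auto simp: permutes_def signed_symbols_def)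
    then show ?thesis using False
      unfolding put_bars_of_nat[where p = "forget_bars \<sigma>", OF f0] by (simp add: forget_bars_def)
  qed
  show ?thesis
  proof
    fix j
    show "put_bars ?B (forget_bars \<sigma>) j = \<sigma> j"
    proof (cases "0 \<le> j")
      case True
      then show ?thesis using nat[of "nat j"] by simp
    next
      case False
      then have "put_bars ?B (forget_bars \<sigma>) (- j) = \<sigma> (- j)" using nat[of "nat (- j)"] by simp
      then show ?thesis unfolding put_bars_minus signed_permutation_minus[OF \<sigma>] by simp
    qed
  qed
qed

lemma card_supersets:
  assumes "finite V" "M \<subseteq> V"
  shows "card {B. V - M \<subseteq> B \<and> B \<subseteq> V} = 2 ^ card M"
proof -
  have "bij_betw (\<lambda>C. C \<union> (V - M)) (Pow M) {B. V - M \<subseteq> B \<and> B \<subseteq> V}"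
    by (rule bij_betw_byWitness[where f' = "\<lambda>B. B \<inter> M"]) (use assms in auto)
  then show ?thesis
    using bij_betw_same_card card_Pow[OF finite_subset[OF assms(2,1)]] by force
qed

text \<open>Signed permutations correspond to pairs of a permutation \<open>p\<close> and a set \<open>B\<close> of barred positions.
  The cycle conditions concern \<open>p\<close> alone, and the absence of fixed points says that \<open>B\<close> contains
  the fixed points of \<open>p\<close>; the other points may be barred freely.\<close>

lemma stirling_B_ge2_eq_weighted_count:
  "stirling_B_ge2 r n k = weighted_count {1..r} {1..n + r} k"
proof -
  let ?V = "{1..n + r}"
  let ?P = "{p. p permutes ?V \<and> separates {1..r} ?V k p}"
  let ?bars = "\<lambda>p. {B. ?V - {x. p x \<noteq> x} \<subseteq> B \<and> B \<subseteq> ?V}"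
  let ?T = "{\<sigma> \<in> derangements_B n r. card (cycles (n + r) \<sigma>) = k + r}"
  have T: "\<sigma> \<in> ?T \<longleftrightarrow> signed_permutation (n + r) \<sigma> \<and> (\<forall>i\<in>?V. \<sigma> (int i) \<noteq> int i)
      \<and> separates {1..r} ?V k (forget_bars \<sigma>)" for \<sigma>
    unfolding derangements_B_def separates_def cycles_def cycle_at_def[abs_def] inj_on_def
    by (auto simp: add.commute)
  have "bij_betw (\<lambda>(p, B). put_bars B p) (Sigma ?P ?bars) ?T"
  proof (rule bij_betw_byWitness[where f' = "\<lambda>\<sigma>. (forget_bars \<sigma>, {i \<in> ?V. \<sigma> (int i) < 0})"])
    have zero: "p 0 = 0" and pos: "i \<in> ?V \<Longrightarrow> p i > 0" if "p \<in> ?P" for p i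
      using that permutes_in_image[of p ?V i] by (auto simp: permutes_def)
    show "\<forall>x\<in>Sigma ?P ?bars. (\<lambda>\<sigma>. (forget_bars \<sigma>, {i \<in> ?V. \<sigma> (int i) < 0}))
        ((\<lambda>(p, B). put_bars B p) x) = x"
    proof clarify
      fix p B assume p: "p permutes ?V" "separates {1..r} ?V k p" and B: "B \<subseteq> ?V"
      have P: "p \<in> ?P" using p by simp
      have "{i \<in> ?V. put_bars B p (int i) < 0} = B"
        unfolding put_bars_of_nat[of p, OF zero[OF P]] using pos[OF P] B by auto
      then show "forget_bars (put_bars B p) = p \<and> {i \<in> ?V. put_bars B p (int i) < 0} = B"
        using forget_bars_put_bars[of p, OF zero[OF P]] by simp
    qed
    show "\<forall>\<sigma>\<in>?T. (\<lambda>(p, B). put_bars B p) (forget_bars \<sigma>, {i \<in> ?V. \<sigma> (int i) < 0}) = \<sigma>"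
    proof
      fix \<sigma> assume "\<sigma> \<in> ?T"
      then have "signed_permutation (n + r) \<sigma>" unfolding T by blast
      then show "(\<lambda>(p, B). put_bars B p) (forget_bars \<sigma>, {i \<in> ?V. \<sigma> (int i) < 0}) = \<sigma>"
        by (simp only: prod.case put_bars_forget_bars)
    qed
    show "(\<lambda>(p, B). put_bars B p) ` Sigma ?P ?bars \<subseteq> ?T"
    proof
      fix \<sigma> assume "\<sigma> \<in> (\<lambda>(p, B). put_bars B p) ` Sigma ?P ?bars"
      then obtain p B where \<sigma>: "\<sigma> = put_bars B p" and P: "p \<in> ?P"
        and B: "?V - {x. p x \<noteq> x} \<subseteq> B" "B \<subseteq> ?V" by auto
      then have p: "p permutes ?V" "separates {1..r} ?V k p" by simp_all
      show "\<sigma> \<in> ?T"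
        unfolding T \<sigma> forget_bars_put_bars[of p, OF zero[OF P]] put_bars_of_nat[of p, OF zero[OF P]]
        using signed_permutation_put_bars[OF p(1) B(2)] p(2) B pos[OF P] by auto
    qed
    show "(\<lambda>\<sigma>. (forget_bars \<sigma>, {i \<in> ?V. \<sigma> (int i) < 0})) ` ?T \<subseteq> Sigma ?P ?bars"
    proof
      fix z assume "z \<in> (\<lambda>\<sigma>. (forget_bars \<sigma>, {i \<in> ?V. \<sigma> (int i) < 0})) ` ?T"
      then obtain \<sigma> where z: "z = (forget_bars \<sigma>, {i \<in> ?V. \<sigma> (int i) < 0})" and "\<sigma> \<in> ?T" by blast
      then have \<sigma>: "signed_permutation (n + r) \<sigma>" "\<And>i. i \<in> ?V \<Longrightarrow> \<sigma> (int i) \<noteq> int i"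
        "separates {1..r} ?V k (forget_bars \<sigma>)" unfolding T by blast+
      have "\<sigma> (int i) < 0" if "i \<in> ?V" "forget_bars \<sigma> i = i" for i
        using \<sigma>(2)[OF that(1)] that(2) unfolding forget_bars_def by linarith
      then show "z \<in> Sigma ?P ?bars"
        unfolding z using \<sigma>(3) signed_permutation_forget_bars[OF \<sigma>(1)] by auto
    qed
  qed
  then have "stirling_B_ge2 r n k = card (Sigma ?P ?bars)"
    unfolding stirling_B_ge2_def by (rule bij_betw_same_card[symmetric])
  also have "\<dots> = (\<Sum>p\<in>?P. card (?bars p))"
  proof (rule card_SigmaI)
    show "finite ?P" by (rule finite_subset[OF _ finite_permutations[of ?V]]) auto
    show "\<forall>p\<in>?P. finite (?bars p)" by (auto intro: finite_subset[of _ "Pow ?V"])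
  qed
  also have "\<dots> = (\<Sum>p\<in>?P. 2 ^ card {x. p x \<noteq> x})"
  proof (rule sum.cong[OF refl])
    fix p assume "p \<in> ?P"
    then have "{x. p x \<noteq> x} \<subseteq> ?V" by (auto dest: permutes_not_in)
    then show "card (?bars p) = 2 ^ card {x. p x \<noteq> x}" by (intro card_supersets) auto
  qed
  finally show ?thesis unfolding weighted_count_def .
qed

lemma stirling_B_ge2_eq_0:
  assumes "n < k"
  shows "stirling_B_ge2 r n k = 0"
proof -
  have "card (cycles (n + r) \<sigma>) \<le> n + r" for \<sigma>
    using card_image_le[of "{1..n + r}" "cycle_at \<sigma>"] by (simp add: cycles_def)
  then have "{\<sigma> \<in> derangements_B n r. card (cycles (n + r) \<sigma>) = k + r} = {}"
    using assms by (metis (mono_tags, lifting) add_le_cancel_right empty_Collect_eq leD)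
  then show ?thesis by (simp only: stirling_B_ge2_def card.empty)
qed

theorem theorem3p1:
  fixes r :: nat
  shows "is_exp_Riordan_array
           (\<lambda>n k. real (stirling_B_ge2 r n k))
           (((1 + 2 * fps_X) / (1 - 2 * fps_X)) ^ r)
           (- (fps_ln 1 oo (- 2 * fps_X)) - fps_X)"
proof -
  define g :: "real fps" where "g = (1 + 2 * fps_X) / (1 - 2 * fps_X)"
  define f :: "real fps" where "f = - (fps_ln 1 oo (- 2 * fps_X)) - fps_X"
  have unit: "(1 - 2 * fps_X :: real fps) $ 0 \<noteq> 0" by (simp add: fps_mult_nth)
  have g: "(1 - 2 * fps_X) * g = 1 + 2 * fps_X"
    unfolding g_def by (simp add: fps_divide_unit[OF unit] inverse_mult_eq_1'[OF unit] mult.left_commute)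
  have inner0: "(- 2 * fps_X :: real fps) $ 0 = 0" by (simp add: fps_mult_nth)
  have "inverse (1 + fps_X) oo (- 2 * fps_X :: real fps) = inverse (1 - 2 * fps_X)"
    using inner0 by (simp add: fps_inverse_compose fps_compose_add_distrib)
  then have df: "fps_deriv f = 2 * inverse (1 - 2 * fps_X) - 1"
    unfolding f_def using inner0
    by (simp add: fps_compose_deriv fps_ln_deriv)
  have f: "(1 - 2 * fps_X) * fps_deriv f = 1 + 2 * fps_X"
    unfolding df right_diff_distrib mult.left_commute[of _ 2] inverse_mult_eq_1'[OF unit] by simp
  have f0: "f $ 0 = 0" unfolding f_def by (simp add: fps_compose_nth_0)
  have g0: "g $ 0 = 1" using arg_cong[OF g, of "\<lambda>h. h $ 0"] by (simp add: fps_mult_nth)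
  have f'0: "fps_deriv f $ 0 = 1" using arg_cong[OF f, of "\<lambda>h. h $ 0"] by (simp add: fps_mult_nth)
  have "real (stirling_B_ge2 r n k) = fact n * Riordan_column g f r k $ n" for n k
  proof -
    have "{1..n + r} - {1..r} = {Suc r..n + r}" by auto
    then show ?thesis
      using weighted_count_eq_coeff[OF g f f0, of "{1..n + r}" "{1..r}" k]
      unfolding stirling_B_ge2_eq_weighted_count by simp
  qed
  then have "Abs_fps (\<lambda>n. real (stirling_B_ge2 r n k) / fact n) = g ^ r * f ^ k / fps_const (fact k)" for k
    by (simp add: fps_eq_iff Riordan_column_def)
  then show ?thesis
    unfolding is_exp_Riordan_array_def g_def[symmetric] f_def[symmetric]
    using g0 f0 f'0 stirling_B_ge2_eq_0 by (simp add: fps_nth_power_0)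
qed

end
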